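(* Let $\mathcal{Z}$ be a subset of $\mathbb{P}^{\pm}$. Let $\pi\in S_n$ and $\sigma\in S_m$ be two permutations, and let $\alpha=(\alpha_1,\ldots,\alpha_n)$ and $\beta=(\beta_1,\ldots,\beta_m)$ be two compositions with $n$ and $m$ entries, respectively. Then $$U^{\mathcal{Z}}_{\pi,\alpha}\,U^{\mathcal{Z}}_{\sigma,\beta}=\sum_{(\tau,\gamma)}U^{\mathcal{Z}}_{\tau,\gamma},$$ where the sum ranges over all pairs $(\tau,\gamma)$ in the coshuffle of $(\pi,\alpha)$ and $(\sigma,\beta)$.
   Context: $\mathbb{P}=\{1,2,3,\ldots\}$ and $[n]=\{1,\ldots,n\}$. A composition is a finite sequence of positive integers. $\mathbf{k}$ is a fixed commutative ring, and all power series lie in $\mathbf{k}[[x_1,x_2,x_3,\ldots]]$. $\mathbb{P}^{\pm}=\{-,+\}\times\mathbb{P}$, with elements written $\pm n$, absolute value $|\pm n|=n$, and total order $-1<1<-2<2<-3<3<\cdots$. $\mathbb{P}$ is identified with the elements $+n$, and $-\mathbb{P}$ is the set of the elements $-n$. A labelled poset $P=([n],<_P)$ is a partial order $<_P$ on $[n]$. An enriched $P$-partition is a map $f:[n]\to\mathbb{P}^{\pm}$ such that: (i) if $i<_P j$ and $i<j$, then $f(i)<f(j)$ or $f(i)=f(j)\in\mathbb{P}$; (ii) if $i<_P j$ and $i>j$, then $f(i)<f(j)$ or $f(i)=f(j)\in-\mathbb{P}$. For $\mathcal{Z}\subseteq\mathbb{P}^{\pm}$, $\mathcal{L}_{\mathcal{Z}}(P)$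 denotes the set of enriched $P$-partitions $f$ with $f([n])\subseteq\mathcal{Z}$. A labelled weighted poset is a triple $([n],<_P,\epsilon)$ with $([n],<_P)$ a labelled poset and $\epsilon:[n]\to\mathbb{P}$ a map; its generating function is $\Gamma_{\mathcal{Z}}([n],<_P,\epsilon)=\sum_{f\in\mathcal{L}_{\mathcal{Z}}([n],<_P)}\prod_{i=1}^{n}x_{|f(i)|}^{\epsilon(i)}$. For $\pi=\pi_1\cdots\pi_n\in S_n$ (one-line notation), $<_\pi$ is the total order on $[n]$ with $\pi_i<_\pi\pi_j$ if and only if $i<j$. For a composition $\alpha=(\alpha_1,\ldots,\alpha_n)$ with $n$ entries, the universal quasisymmetric function $U^{\mathcal{Z}}_{\pi,\alpha}$ is $\Gamma_{\mathcal{Z}}([n],<_\pi,\epsilon)$, where $\epsilon(\pi_i)=\alpha_i$ for all $i$. The coshuffle of $(\pi,\alpha)$ and $(\sigma,\beta)$ (with $\pi\in S_n$, $\sigma\in S_m$, and $\alpha,\beta$ having $n$ and $m$ entries) is the set of pairs $(\tau,\gamma)$ where $\tau\in S_{n+m}$ is a shuffle of the words $\pi_1\cdots\pi_n$ and $(n+\sigma_1)\cdots(n+\sigma_m)$ (i.e. contains both as subwords), and $\gamma$ is the composition with $n+m$ entries obtained by shuffling the entries of $\alpha$ and $\beta$ by the same shuffle: if $\tau_k=\pi_i$ then $\gamma_k=\alpha_i$, and if $\tau_k=n+\sigma_j$ then $\gamma_k=\beta_j$. *)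

theory Defs
  imports "HOL-Library.Poly_Mapping" "HOL-Combinatorics.Permutations"
begin

section \<open>Formal power series in arbitrarily many commuting variables\<close>

text \<open>
  A power series in variables indexed by \<^typ>\<open>'v\<close> is an arbitrary family of coefficients indexed
  by the monomials, a monomial being a finitely supported exponent function \<^typ>\<open>'v \<Rightarrow>\<^sub>0 nat\<close>.
\<close>

typedef ('v, 'a) mpowser = "UNIV :: (('v \<Rightarrow>\<^sub>0 nat) \<Rightarrow> 'a) set"
  morphisms coeff Abs_mpowser ..

setup_lifting type_definition_mpowser

lemma mpowser_eqI: "(\<And>m. coeff F m = coeff G m) \<Longrightarrow> F = G"
  by transfer auto

definition splits :: "('v \<Rightarrow>\<^sub>0 nat) \<Rightarrow> (('v \<Rightarrow>\<^sub>0 nat) \<times> ('v \<Rightarrow>\<^sub>0 nat)) set" where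
  "splits m = {(a, b). a + b = m}"

lemma finite_splits: "finite (splits m)"
proof -
  let ?B = "\<Union>v\<in>Poly_Mapping.keys m. {..Poly_Mapping.lookup m v}"
  let ?S = "{g. \<forall>x. (x \<in> Poly_Mapping.keys m \<longrightarrow> g x \<in> ?B) \<and> (x \<notin> Poly_Mapping.keys m \<longrightarrow> g x = 0)}"
  have fin: "finite ?S"
    by (rule finite_set_of_finite_funs) auto
  have sub: "Poly_Mapping.lookup a \<in> ?S" if "a + b = m" for a b
  proof -
    have le: "Poly_Mapping.lookup a x \<le> Poly_Mapping.lookup m x" for x
      using that by (auto simp: lookup_add)
    show ?thesis
    proof (intro CollectI allI conjI impI)
      fix x assume "x \<in> Poly_Mapping.keys m"
      then show "Poly_Mapping.lookup a x \<in> ?B" using le[of x] by blast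
    next
      fix x assume "x \<notin> Poly_Mapping.keys m"
      then show "Poly_Mapping.lookup a x = 0" using le[of x] by (simp add: in_keys_iff)
    qed
  qed
  have "finite (Poly_Mapping.lookup -` ?S)"
    by (rule finite_vimageI[OF fin]) (auto intro!: injI poly_mapping_eqI)
  moreover have "splits m \<subseteq> (Poly_Mapping.lookup -` ?S) \<times> (Poly_Mapping.lookup -` ?S)"
  proof
    fix p assume "p \<in> splits m"
    then obtain a b where p: "p = (a, b)" and ab: "a + b = m"
      by (auto simp: splits_def)
    then have "b + a = m" by (simp add: add.commute)
    with sub[OF ab] sub[of b a] show "p \<in> (Poly_Mapping.lookup -` ?S) \<times> (Poly_Mapping.lookup -` ?S)"
      unfolding p by blast
  qed
  ultimately show ?thesis
    by (meson finite_SigmaI finite_subset)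
qed

text \<open>
  The coefficients form a commutative ring with unit.  The sort below is the class
  \<^class>\<open>comm_ring_1\<close> without the requirement \<open>0 \<noteq> 1\<close>, so the zero ring is not excluded.
\<close>

instantiation mpowser :: (type, "{comm_ring, comm_monoid_mult}") "{comm_ring, comm_monoid_mult}"
begin

lift_definition zero_mpowser :: "('a, 'b) mpowser" is "\<lambda>m. 0" .
lift_definition one_mpowser :: "('a, 'b) mpowser" is "\<lambda>m. if m = 0 then 1 else 0" .
lift_definition plus_mpowser :: "('a, 'b) mpowser \<Rightarrow> ('a, 'b) mpowser \<Rightarrow> ('a, 'b) mpowser"
  is "\<lambda>F G m. F m + G m" .
lift_definition minus_mpowser :: "('a, 'b) mpowser \<Rightarrow> ('a, 'b) mpowser \<Rightarrow> ('a, 'b) mpowser"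
  is "\<lambda>F G m. F m - G m" .
lift_definition uminus_mpowser :: "('a, 'b) mpowser \<Rightarrow> ('a, 'b) mpowser"
  is "\<lambda>F m. - F m" .
lift_definition times_mpowser :: "('a, 'b) mpowser \<Rightarrow> ('a, 'b) mpowser \<Rightarrow> ('a, 'b) mpowser"
  is "\<lambda>F G m. \<Sum>(a, b)\<in>splits m. F a * G b" .

instance
proof
  fix F G H :: "('a, 'b) mpowser"
  show "F * G * H = F * (G * H)"
  proof (transfer, rule ext)
    fix F G H :: "('a \<Rightarrow>\<^sub>0 nat) \<Rightarrow> 'b" and m
    have "(\<Sum>(p, c)\<in>splits m. (\<Sum>(a, b)\<in>splits p. F a * G b) * H c)
        = (\<Sum>x\<in>splits m. \<Sum>y\<in>splits (fst x). F (fst y) * G (snd y) * H (snd x))"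
      by (simp add: case_prod_unfold sum_distrib_right)
    also have "\<dots> = (\<Sum>(x, y)\<in>(SIGMA x:splits m. splits (fst x)). F (fst y) * G (snd y) * H (snd x))"
      by (rule sum.Sigma) (auto simp: finite_splits)
    also have "\<dots> = (\<Sum>(x, y)\<in>(SIGMA x:splits m. splits (snd x)). F (fst x) * (G (fst y) * H (snd y)))"
      by (rule sum.reindex_bij_witness
            [where i = "\<lambda>(x, y). ((fst x + fst y, snd y), (fst x, fst y))"
               and j = "\<lambda>(x, y). ((fst y, snd y + snd x), (snd y, snd x))"])
         (auto simp: splits_def ac_simps)
    also have "\<dots> = (\<Sum>x\<in>splits m. \<Sum>y\<in>splits (snd x). F (fst x) * (G (fst y) * H (snd y)))"
      by (rule sum.Sigma[symmetric]) (auto simp: finite_splits)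
    also have "\<dots> = (\<Sum>(a, q)\<in>splits m. F a * (\<Sum>(b, c)\<in>splits q. G b * H c))"
      by (simp add: case_prod_unfold sum_distrib_left)
    finally show "(\<Sum>(p, c)\<in>splits m. (\<Sum>(a, b)\<in>splits p. F a * G b) * H c)
      = (\<Sum>(a, q)\<in>splits m. F a * (\<Sum>(b, c)\<in>splits q. G b * H c))" .
  qed
  show "F * G = G * F"
  proof (transfer, rule ext)
    fix F G :: "('a \<Rightarrow>\<^sub>0 nat) \<Rightarrow> 'b" and m
    show "(\<Sum>(a, b)\<in>splits m. F a * G b) = (\<Sum>(a, b)\<in>splits m. G a * F b)"
      by (rule sum.reindex_bij_witness[where i = prod.swap and j = prod.swap])
         (auto simp: splits_def ac_simps)
  qed
  show "1 * F = F"
  proof (transfer, rule ext)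
    fix F :: "('a \<Rightarrow>\<^sub>0 nat) \<Rightarrow> 'b" and m
    have "(\<Sum>(a, b)\<in>splits m. (if a = 0 then 1 else 0) * F b)
        = (\<Sum>(a, b)\<in>{(0 :: 'a \<Rightarrow>\<^sub>0 nat, m)}. (if a = 0 then 1 else 0) * F b)"
      by (rule sum.mono_neutral_right[OF finite_splits]) (auto simp: splits_def split: if_splits)
    then show "(\<Sum>(a, b)\<in>splits m. (if a = 0 then 1 else 0) * F b) = F m"
      by simp
  qed
  show "(F + G) * H = F * H + G * H"
    by transfer (auto simp: fun_eq_iff case_prod_unfold distrib_right sum.distrib)
  show "F + G + H = F + (G + H)" by transfer (auto simp: ac_simps)
  show "F + G = G + F" by transfer (auto simp: ac_simps)
  show "0 + F = F" by transfer auto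
  show "- F + F = 0" by transfer auto
  show "F - G = F + - G" by transfer (auto simp: fun_eq_iff)
qed

end

definition monom :: "('v \<Rightarrow>\<^sub>0 nat) \<Rightarrow> ('v, 'a::{zero, one}) mpowser" where
  "monom a = Abs_mpowser (\<lambda>m. if m = a then 1 else 0)"

lemma coeff_monom: "coeff (monom a) m = (if m = a then 1 else 0)"
  by (simp add: monom_def Abs_mpowser_inverse)

definition Var :: "'v \<Rightarrow> ('v, 'a::{zero, one}) mpowser" where
  "Var v = monom (Poly_Mapping.single v 1)"

lemma monom_0: "monom 0 = 1"
  by (rule mpowser_eqI) (simp add: coeff_monom one_mpowser.rep_eq)

lemma monom_mult:
  "monom a * monom b = (monom (a + b) :: ('v, 'a::{comm_ring, comm_monoid_mult}) mpowser)"
proof (rule mpowser_eqI)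
  fix m
  have "(\<Sum>(p, q)\<in>splits m. (if p = a then 1 else 0) * (if q = b then 1 else 0 :: 'a))
      = (\<Sum>(p, q)\<in>(if a + b = m then {(a, b)} else {}). 1)"
    by (rule sum.mono_neutral_cong_right[OF finite_splits]) (auto simp: splits_def split: if_splits)
  then show "coeff (monom a * monom b) m = coeff (monom (a + b) :: ('v, 'a) mpowser) m"
    by (auto simp: times_mpowser.rep_eq coeff_monom split: if_splits)
qed

lemma Var_power:
  "Var v ^ k = (monom (Poly_Mapping.single v k) :: ('v, 'a::{comm_ring, comm_monoid_mult}) mpowser)"
  by (induction k) (simp_all add: monom_0 Var_def monom_mult single_add[symmetric])

lemma prod_Var_power:
  "finite I \<Longrightarrow> (\<Prod>i\<in>I. Var (v i) ^ k i)
    = (monom (\<Sum>i\<in>I. Poly_Mapping.single (v i) (k i)) :: ('v, 'a::{comm_ring, comm_monoid_mult}) mpowser)"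
  by (induction I rule: finite_induct) (simp_all add: monom_0 Var_power monom_mult)

text \<open>
  Infinite sums of power series are taken coefficientwise.  They are meaningful for families
  satisfying \<open>mp_summable\<close>, in which every monomial receives finitely many nonzero contributions.
\<close>

definition mp_summable :: "('i \<Rightarrow> ('v, 'a::comm_monoid_add) mpowser) \<Rightarrow> 'i set \<Rightarrow> bool" where
  "mp_summable F I \<longleftrightarrow> (\<forall>m. finite {i \<in> I. coeff (F i) m \<noteq> 0})"

definition mp_infsum :: "('i \<Rightarrow> ('v, 'a::comm_monoid_add) mpowser) \<Rightarrow> 'i set \<Rightarrow> ('v, 'a) mpowser" where
  "mp_infsum F I = Abs_mpowser (\<lambda>m. \<Sum>i\<in>{i \<in> I. coeff (F i) m \<noteq> 0}. coeff (F i) m)"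


section \<open>Enriched partitions and their generating functions\<close>

text \<open>
  \<^typ>\<open>num\<close> is the linearly ordered type of the positive integers \<open>1, 2, 3, \<dots>\<close>
  (embedded into \<^typ>\<open>nat\<close> by \<^const>\<open>nat_of_num\<close>).
\<close>

type_synonym pos = num

text \<open>\<open>Minus n\<close> and \<open>Plus n\<close> are the elements \<open>-n\<close> and \<open>+n\<close> of the doubled positive integers.\<close>

datatype spos = Minus pos | Plus pos

primrec absval :: "spos \<Rightarrow> pos" where
  "absval (Minus n) = n"
| "absval (Plus n) = n"

text \<open>The order is \<open>-1 < +1 < -2 < +2 < -3 < +3 < \<dots>\<close>\<close>

instantiation spos :: linorder
begin

definition less_spos :: "spos \<Rightarrow> spos \<Rightarrow> bool" where
  "a < b \<longleftrightarrow> absval a < absval b \<or> (\<exists>n. a = Minus n \<and> b = Plus n)"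

definition less_eq_spos :: "spos \<Rightarrow> spos \<Rightarrow> bool" where
  "a \<le> b \<longleftrightarrow> a < b \<or> a = (b :: spos)"

instance
proof
  fix a b c :: spos
  show "(a < b) = (a \<le> b \<and> \<not> b \<le> a)"
    by (cases a; cases b) (auto simp: less_spos_def less_eq_spos_def)
  show "a \<le> a" by (simp add: less_eq_spos_def)
  show "a \<le> b \<Longrightarrow> b \<le> c \<Longrightarrow> a \<le> c"
    by (cases a; cases b; cases c) (auto simp: less_spos_def less_eq_spos_def)
  show "a \<le> b \<Longrightarrow> b \<le> a \<Longrightarrow> a = b"
    by (cases a; cases b) (auto simp: less_spos_def less_eq_spos_def)
  show "a \<le> b \<or> b \<le> a"
    by (cases a; cases b) (auto simp: less_spos_def less_eq_spos_def)
qed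

end

text \<open>The relation \<open>P\<close> is the strict order: \<open>(i, j) \<in> P\<close> means that \<open>i\<close> is strictly below \<open>j\<close>.\<close>

definition labelled_poset :: "nat \<Rightarrow> nat rel \<Rightarrow> bool" where
  "labelled_poset n P \<longleftrightarrow> P \<subseteq> {1..n} \<times> {1..n} \<and> irrefl P \<and> trans P"

definition enriched_partitions :: "spos set \<Rightarrow> nat \<Rightarrow> nat rel \<Rightarrow> (nat \<Rightarrow> spos) set" where
  "enriched_partitions Z n P = {f \<in> {1..n} \<rightarrow>\<^sub>E Z. \<forall>(i, j) \<in> P.
     (i < j \<longrightarrow> f i < f j \<or> (f i = f j \<and> f i \<in> range Plus)) \<and>
     (i > j \<longrightarrow> f i < f j \<or> (f i = f j \<and> f i \<in> range Minus))}"

definition weight_monomial ::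
  "nat \<Rightarrow> (nat \<Rightarrow> pos) \<Rightarrow> (nat \<Rightarrow> spos) \<Rightarrow> (pos, 'k::{comm_ring, comm_monoid_mult}) mpowser" where
  "weight_monomial n \<epsilon> f = (\<Prod>i\<in>{1..n}. Var (absval (f i)) ^ nat_of_num (\<epsilon> i))"

definition gen_fun ::
  "spos set \<Rightarrow> nat \<Rightarrow> nat rel \<Rightarrow> (nat \<Rightarrow> pos) \<Rightarrow> (pos, 'k::{comm_ring, comm_monoid_mult}) mpowser" where
  "gen_fun Z n P \<epsilon> = mp_infsum (weight_monomial n \<epsilon>) (enriched_partitions Z n P)"

lemma mp_summable_gen_fun:
  "mp_summable (weight_monomial n \<epsilon> :: _ \<Rightarrow> (pos, 'k::{comm_ring, comm_monoid_mult}) mpowser)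
     (enriched_partitions Z n P)"
  unfolding mp_summable_def
proof
  fix m :: "pos \<Rightarrow>\<^sub>0 nat"
  let ?K = "Poly_Mapping.keys m"
  have "f \<in> {1..n} \<rightarrow>\<^sub>E Minus ` ?K \<union> Plus ` ?K"
    if f: "f \<in> enriched_partitions Z n P" and nz: "coeff (weight_monomial n \<epsilon> f) m \<noteq> (0 :: 'k)" for f
  proof (rule PiE_I)
    let ?g = "\<lambda>i. Poly_Mapping.single (absval (f i)) (nat_of_num (\<epsilon> i))"
    have m: "m = (\<Sum>i\<in>{1..n}. ?g i)"
      using nz by (simp add: weight_monomial_def prod_Var_power coeff_monom split: if_splits)
    fix i assume i: "i \<in> {1..n}"
    have "Poly_Mapping.lookup (?g i) (absval (f i)) \<le> Poly_Mapping.lookup m (absval (f i))"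
      unfolding m lookup_sum by (rule member_le_sum) (use i in auto)
    then have "absval (f i) \<in> ?K"
      using nat_of_num_pos[of "\<epsilon> i"] by (simp add: in_keys_iff)
    then show "f i \<in> Minus ` ?K \<union> Plus ` ?K"
      by (cases "f i") auto
  next
    fix i assume "i \<notin> {1..n}"
    then show "f i = undefined"
      using f by (auto simp: enriched_partitions_def PiE_def extensional_def)
  qed
  then have "{f \<in> enriched_partitions Z n P. coeff (weight_monomial n \<epsilon> f) m \<noteq> (0 :: 'k)}
      \<subseteq> {1..n} \<rightarrow>\<^sub>E Minus ` ?K \<union> Plus ` ?K"
    by blast
  then show "finite {f \<in> enriched_partitions Z n P. coeff (weight_monomial n \<epsilon> f) m \<noteq> (0 :: 'k)}"
    by (rule finite_subset) (intro finite_PiE, auto)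
qed


section \<open>Universal quasisymmetric functions and coshuffles\<close>

definition perm_order :: "nat \<Rightarrow> (nat \<Rightarrow> nat) \<Rightarrow> nat rel" where
  "perm_order n \<pi> = {(\<pi> i, \<pi> j) | i j. i \<in> {1..n} \<and> j \<in> {1..n} \<and> i < j}"

text \<open>
  Compositions are lists of positive integers; list positions count from \<open>0\<close>, so the \<open>i\<close>-th entry
  of \<open>\<alpha>\<close> is \<open>\<alpha> ! (i - 1)\<close>.  The weight below sends \<open>\<pi> i\<close> to that entry.
\<close>

definition perm_weight :: "(nat \<Rightarrow> nat) \<Rightarrow> pos list \<Rightarrow> nat \<Rightarrow> pos" where
  "perm_weight \<pi> \<alpha> j = \<alpha> ! (inv \<pi> j - 1)"

definition univ_qsym ::
  "spos set \<Rightarrow> (nat \<Rightarrow> nat) \<Rightarrow> pos list \<Rightarrow> (pos, 'k::{comm_ring, comm_monoid_mult}) mpowser" where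
  "univ_qsym Z \<pi> \<alpha> = gen_fun Z (length \<alpha>) (perm_order (length \<alpha>) \<pi>) (perm_weight \<pi> \<alpha>)"

definition one_line :: "nat \<Rightarrow> (nat \<Rightarrow> nat) \<Rightarrow> nat list" where
  "one_line n \<pi> = map \<pi> [1..<n + 1]"

definition coshuffle ::
  "(nat \<Rightarrow> nat) \<Rightarrow> pos list \<Rightarrow> (nat \<Rightarrow> nat) \<Rightarrow> pos list \<Rightarrow> ((nat \<Rightarrow> nat) \<times> pos list) set" where
  "coshuffle \<pi> \<alpha> \<sigma> \<beta> = (let n = length \<alpha>; m = length \<beta> in
     {(\<tau>, \<gamma>). \<tau> permutes {1..n + m} \<and>
        one_line (n + m) \<tau> \<in> shuffles (one_line n \<pi>) (map (\<lambda>s. n + s) (one_line m \<sigma>)) \<and>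
        length \<gamma> = n + m \<and>
        (\<forall>k\<in>{1..n + m}.
           (\<forall>i\<in>{1..n}. \<tau> k = \<pi> i \<longrightarrow> \<gamma> ! (k - 1) = \<alpha> ! (i - 1)) \<and>
           (\<forall>j\<in>{1..m}. \<tau> k = n + \<sigma> j \<longrightarrow> \<gamma> ! (k - 1) = \<beta> ! (j - 1)))})"

lemma labelled_poset_perm_order:
  assumes "\<pi> permutes {1..n}"
  shows "labelled_poset n (perm_order n \<pi>)" and "total_on {1..n} (perm_order n \<pi>)"
proof -
  have inj: "\<pi> i = \<pi> j \<Longrightarrow> i = j" for i j
    using permutes_inj[OF assms] by (rule injD)
  have "perm_order n \<pi> \<subseteq> {1..n} \<times> {1..n}"
    using permutes_in_image[OF assms] unfolding perm_order_def by blast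
  moreover have "irrefl (perm_order n \<pi>)"
    unfolding irrefl_def perm_order_def using inj by blast
  moreover have "trans (perm_order n \<pi>)"
  proof (rule transI)
    fix x y z assume "(x, y) \<in> perm_order n \<pi>" "(y, z) \<in> perm_order n \<pi>"
    then obtain i j j' k where *: "x = \<pi> i" "y = \<pi> j" "y = \<pi> j'" "z = \<pi> k"
        "i \<in> {1..n}" "k \<in> {1..n}" "i < j" "j' < k"
      unfolding perm_order_def by blast
    then have "j = j'" using inj by metis
    with * have "i < k" by simp
    with * show "(x, z) \<in> perm_order n \<pi>"
      unfolding perm_order_def by blast
  qed
  ultimately show "labelled_poset n (perm_order n \<pi>)"
    by (simp add: labelled_poset_def)
  show "total_on {1..n} (perm_order n \<pi>)"
  proof (rule total_onI)
    fix x y assume xy: "x \<in> {1..n}" "y \<in> {1..n}" "x \<noteq> y"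
    then obtain i j where ij: "i \<in> {1..n}" "x = \<pi> i" "j \<in> {1..n}" "y = \<pi> j"
      using permutes_image[OF assms] by (metis imageE)
    with xy(3) have "i < j \<or> j < i" by (metis linorder_neqE_nat)
    with ij show "(x, y) \<in> perm_order n \<pi> \<or> (y, x) \<in> perm_order n \<pi>"
      unfolding perm_order_def by blast
  qed
qed

lemma perm_weight_apply: "\<pi> permutes {1..n} \<Longrightarrow> perm_weight \<pi> \<alpha> (\<pi> i) = \<alpha> ! (i - 1)"
  by (simp add: perm_weight_def permutes_inverses)

lemma finite_coshuffle:
  assumes "\<pi> permutes {1..length \<alpha>}" "\<sigma> permutes {1..length \<beta>}"
  shows "finite (coshuffle \<pi> \<alpha> \<sigma> \<beta>)"
proof -
  let ?n = "length \<alpha>" and ?m = "length \<beta>"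
  let ?T = "{\<tau>. \<tau> permutes {1..?n + ?m}}"
  let ?G = "{\<gamma>. set \<gamma> \<subseteq> set \<alpha> \<union> set \<beta> \<and> length \<gamma> = ?n + ?m}"
  have "set \<gamma> \<subseteq> set \<alpha> \<union> set \<beta>" if "(\<tau>, \<gamma>) \<in> coshuffle \<pi> \<alpha> \<sigma> \<beta>" for \<tau> \<gamma>
  proof
    fix x assume "x \<in> set \<gamma>"
    then obtain l where l: "l < length \<gamma>" "x = \<gamma> ! l"
      by (auto simp: in_set_conv_nth)
    define k where "k = Suc l"
    have k: "k \<in> {1..?n + ?m}" "x = \<gamma> ! (k - 1)" and \<tau>: "\<tau> permutes {1..?n + ?m}"
      using l that by (auto simp: k_def coshuffle_def Let_def)
    have val: "\<tau> k = \<pi> i \<Longrightarrow> i \<in> {1..?n} \<Longrightarrow> x = \<alpha> ! (i - 1)"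
              "\<tau> k = ?n + \<sigma> i \<Longrightarrow> i \<in> {1..?m} \<Longrightarrow> x = \<beta> ! (i - 1)" for i
      using that k by (auto simp: coshuffle_def Let_def)
    have "\<tau> k \<in> {1..?n + ?m}"
      using permutes_in_image[OF \<tau>] k(1) by blast
    then consider "\<tau> k \<in> {1..?n}" | "\<tau> k - ?n \<in> {1..?m}" "\<tau> k = ?n + (\<tau> k - ?n)"
      by (cases "\<tau> k \<le> ?n") auto
    then show "x \<in> set \<alpha> \<union> set \<beta>"
    proof cases
      case 1
      then obtain i where "i \<in> {1..?n}" "\<tau> k = \<pi> i"
        using permutes_image[OF assms(1)] by (metis imageE)
      with val(1)[of i] show ?thesis by auto
    next
      case 2
      then obtain i where "i \<in> {1..?m}" "\<tau> k = ?n + \<sigma> i"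
        using permutes_image[OF assms(2)] by (metis imageE)
      with val(2)[of i] show ?thesis by auto
    qed
  qed
  then have "coshuffle \<pi> \<alpha> \<sigma> \<beta> \<subseteq> ?T \<times> ?G"
    by (auto simp: coshuffle_def Let_def)
  moreover have "finite (?T \<times> ?G)"
    by (intro finite_cartesian_product finite_permutations finite_lists_length_eq) auto
  ultimately show ?thesis
    by (rule finite_subset)
qed

end

theory Submission
  imports Defs
begin

text \<open>
  An enriched partition \<open>h\<close> induces a strict total order on \<open>[n]\<close> that refines the order of its
  values, and \<open>h\<close> is an enriched \<open>P\<close>-partition iff this order extends \<open>P\<close>.  Hence the enriched
  \<open>P\<close>-partitions are the disjoint union of those of the linear extensions of \<open>P\<close>.  The product of the
  two series is the generating function of the disjoint sum of the two chains, whose linear extensions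
  are the shuffles.
\<close>

section \<open>Coefficients of generating functions\<close>

text \<open>The exponent vector of the monomial of \<open>f\<close>. It does not involve the
  coefficient ring, so identities of series reduce to bijections between finite sets of
  partitions.\<close>

definition weight_exponent :: "nat \<Rightarrow> (nat \<Rightarrow> pos) \<Rightarrow> (nat \<Rightarrow> spos) \<Rightarrow> (pos \<Rightarrow>\<^sub>0 nat)" where
  "weight_exponent n \<epsilon> f = (\<Sum>i\<in>{1..n}. Poly_Mapping.single (absval (f i)) (nat_of_num (\<epsilon> i)))"

definition partitions_of_weight ::
  "spos set \<Rightarrow> nat \<Rightarrow> nat rel \<Rightarrow> (nat \<Rightarrow> pos) \<Rightarrow> (pos \<Rightarrow>\<^sub>0 nat) \<Rightarrow> (nat \<Rightarrow> spos) set" where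
  "partitions_of_weight Z n P \<epsilon> e = {f \<in> enriched_partitions Z n P. weight_exponent n \<epsilon> f = e}"

lemma weight_monomial_eq_monom:
  "weight_monomial n \<epsilon> f
    = (monom (weight_exponent n \<epsilon> f) :: (pos, 'k::{comm_ring, comm_monoid_mult}) mpowser)"
  by (simp add: weight_monomial_def weight_exponent_def prod_Var_power)

text \<open>The coefficient ring may be trivial, so finiteness is read off from integer coefficients.\<close>

lemma finite_partitions_of_weight: "finite (partitions_of_weight Z n P \<epsilon> e)"
proof -
  have "finite {f \<in> enriched_partitions Z n P.
      coeff (weight_monomial n \<epsilon> f :: (pos, int) mpowser) e \<noteq> 0}"
    using mp_summable_gen_fun[of n \<epsilon> Z P, where 'k = int] unfolding mp_summable_def by blast
  also have "{f \<in> enriched_partitions Z n P.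
      coeff (weight_monomial n \<epsilon> f :: (pos, int) mpowser) e \<noteq> 0} = partitions_of_weight Z n P \<epsilon> e"
    by (auto simp: partitions_of_weight_def weight_monomial_eq_monom coeff_monom)
  finally show ?thesis .
qed

text \<open>Each partition of weight \<open>e\<close> contributes 1 and every other one 0, so
  coefficients count partitions, the count being kept as a sum of ones in the ring.\<close>

lemma coeff_gen_fun:
  "coeff (gen_fun Z n P \<epsilon> :: (pos, 'k::{comm_ring, comm_monoid_mult}) mpowser) e
    = (\<Sum>f\<in>partitions_of_weight Z n P \<epsilon> e. 1)"
proof -
  have "coeff (gen_fun Z n P \<epsilon> :: (pos, 'k) mpowser) e =
    (\<Sum>f\<in>{f \<in> enriched_partitions Z n P. coeff (weight_monomial n \<epsilon> f :: (pos, 'k) mpowser) e \<noteq> 0}.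
       coeff (weight_monomial n \<epsilon> f) e)"
    by (simp add: gen_fun_def mp_infsum_def Abs_mpowser_inverse)
  also have "\<dots> = (\<Sum>f\<in>partitions_of_weight Z n P \<epsilon> e. 1)"
    \<comment> \<open>If \<open>1 = 0\<close> in the ring, the index set on the left is empty and
      the two index sets may differ; the terms added on the right then vanish.\<close>
    by (rule sum.mono_neutral_cong_left[OF finite_partitions_of_weight])
       (auto simp: partitions_of_weight_def weight_monomial_eq_monom coeff_monom split: if_splits)
  finally show ?thesis .
qed

lemma coeff_sum: "coeff (sum F A) e = (\<Sum>i\<in>A. coeff (F i) e)"
  by (induction A rule: infinite_finite_induct)
     (simp_all add: zero_mpowser.rep_eq plus_mpowser.rep_eq)

lemma gen_fun_cong:
  assumes "\<And>i. i \<in> {1..n} \<Longrightarrow> \<epsilon> i = \<delta> i"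
  shows "gen_fun Z n P \<epsilon> = (gen_fun Z n P \<delta> :: (pos, 'k::{comm_ring, comm_monoid_mult}) mpowser)"
proof -
  have "weight_monomial n \<epsilon> = (weight_monomial n \<delta> :: _ \<Rightarrow> (pos, 'k) mpowser)"
    unfolding weight_monomial_def fun_eq_iff using assms by (intro allI prod.cong) auto
  then show ?thesis by (simp add: gen_fun_def)
qed

section \<open>Disjoint sums of labelled posets\<close>

text \<open>Labels start at 1, so those up to \<open>n\<close> form the first block and the next
  \<open>m\<close> labels the second. The gluing serves both weights and enriched
  partitions.\<close>

definition append_fun :: "nat \<Rightarrow> (nat \<Rightarrow> 'a) \<Rightarrow> (nat \<Rightarrow> 'a) \<Rightarrow> nat \<Rightarrow> 'a" where
  "append_fun n f g i = (if i \<le> n then f i else g (i - n))"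

text \<open>No pair links the two blocks, and the shift by \<open>n\<close> is the one applied to
  the second word of a coshuffle.\<close>

definition sum_rel :: "nat \<Rightarrow> nat rel \<Rightarrow> nat rel \<Rightarrow> nat rel" where
  "sum_rel n P Q = P \<union> map_prod ((+) n) ((+) n) ` Q"

lemma weight_exponent_append:
  "weight_exponent (n + m) (append_fun n \<epsilon> \<delta>) h
    = weight_exponent n \<epsilon> h + weight_exponent m \<delta> (\<lambda>i. h (n + i))"
proof -
  let ?s = "\<lambda>i. Poly_Mapping.single (absval (h i)) (nat_of_num (append_fun n \<epsilon> \<delta> i))"
  have "(\<Sum>i\<in>{1..n + m}. ?s i) = (\<Sum>i\<in>{1..n}. ?s i) + (\<Sum>i\<in>{n + 1..n + m}. ?s i)"
    by (rule sum.ub_add_nat) simp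
  also have "(\<Sum>i\<in>{n + 1..n + m}. ?s i) = (\<Sum>i\<in>{1..m}. ?s (n + i))"
    using sum.shift_bounds_cl_nat_ivl[of ?s 1 n m] by (simp add: add.commute)
  finally show ?thesis
    by (simp add: weight_exponent_def append_fun_def)
qed

lemma weight_exponent_cong:
  "(\<And>i. i \<in> {1..n} \<Longrightarrow> f i = g i) \<Longrightarrow> weight_exponent n \<epsilon> f = weight_exponent n \<epsilon> g"
  unfolding weight_exponent_def by (rule sum.cong) auto

text \<open>The conditions separate because no pair of the relation crosses between the blocks, and
  adding \<open>n\<close> to both labels of a pair preserves which one is larger.\<close>

lemma enriched_partitions_sum_rel:
  assumes P: "P \<subseteq> {1..n} \<times> {1..n}" and Q: "Q \<subseteq> {1..m} \<times> {1..m}"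
    and ext: "h \<in> extensional {1..n + m}"
  shows "h \<in> enriched_partitions Z (n + m) (sum_rel n P Q) \<longleftrightarrow>
    restrict h {1..n} \<in> enriched_partitions Z n P \<and>
    restrict (\<lambda>i. h (n + i)) {1..m} \<in> enriched_partitions Z m Q"
proof -
  let ?ok = "\<lambda>(f :: nat \<Rightarrow> spos) (i :: nat, j).
     (i < j \<longrightarrow> f i < f j \<or> (f i = f j \<and> f i \<in> range Plus)) \<and>
     (i > j \<longrightarrow> f i < f j \<or> (f i = f j \<and> f i \<in> range Minus))"
  let ?f = "restrict h {1..n}" and ?g = "restrict (\<lambda>i. h (n + i)) {1..m}"
  have "{1..n + m} = {1..n} \<union> (+) n ` {1..m}"
    by auto
  then have "(\<forall>i\<in>{1..n + m}. h i \<in> Z) \<longleftrightarrow> (\<forall>i\<in>{1..n}. h i \<in> Z) \<and> (\<forall>i\<in>{1..m}. h (n + i) \<in> Z)"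
    by blast
  then have "h \<in> {1..n + m} \<rightarrow>\<^sub>E Z \<longleftrightarrow> ?f \<in> {1..n} \<rightarrow>\<^sub>E Z \<and> ?g \<in> {1..m} \<rightarrow>\<^sub>E Z"
    using ext by (simp add: PiE_iff)
  moreover have "(\<forall>p\<in>sum_rel n P Q. ?ok h p) \<longleftrightarrow>
      (\<forall>p\<in>P. ?ok h p) \<and> (\<forall>p\<in>Q. ?ok (\<lambda>i. h (n + i)) p)"
    by (simp only: sum_rel_def ball_Un ball_simps case_prod_unfold fst_map_prod snd_map_prod
          nat_add_left_cancel_less comp_apply)
  moreover have "(\<forall>p\<in>P. ?ok h p) \<longleftrightarrow> (\<forall>p\<in>P. ?ok ?f p)"
  proof (rule ball_cong[OF refl])
    fix p assume "p \<in> P"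
    then have "fst p \<in> {1..n}" "snd p \<in> {1..n}" using P by auto
    then show "?ok h p \<longleftrightarrow> ?ok ?f p"
      by (simp only: case_prod_unfold restrict_apply if_True)
  qed
  moreover have "(\<forall>p\<in>Q. ?ok (\<lambda>i. h (n + i)) p) \<longleftrightarrow> (\<forall>p\<in>Q. ?ok ?g p)"
  proof (rule ball_cong[OF refl])
    fix p assume "p \<in> Q"
    then have "fst p \<in> {1..m}" "snd p \<in> {1..m}" using Q by auto
    then show "?ok (\<lambda>i. h (n + i)) p \<longleftrightarrow> ?ok ?g p"
      by (simp only: case_prod_unfold restrict_apply if_True)
  qed
  ultimately show ?thesis
    by (simp only: enriched_partitions_def mem_Collect_eq conj_ac)
qed

text \<open>The Cauchy product at \<open>e\<close> counts pairs of partitions whose weights add up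
  to \<open>e\<close>. Gluing such a pair is a bijection onto the partitions of weight
  \<open>e\<close> of the disjoint sum.\<close>

lemma gen_fun_mult:
  assumes P: "P \<subseteq> {1..n} \<times> {1..n}" and Q: "Q \<subseteq> {1..m} \<times> {1..m}"
  shows "gen_fun Z n P \<epsilon> * gen_fun Z m Q \<delta>
    = (gen_fun Z (n + m) (sum_rel n P Q) (append_fun n \<epsilon> \<delta>)
        :: (pos, 'k::{comm_ring, comm_monoid_mult}) mpowser)"
proof (rule mpowser_eqI)
  fix e
  let ?A = "partitions_of_weight Z n P \<epsilon>" and ?B = "partitions_of_weight Z m Q \<delta>"
  let ?C = "partitions_of_weight Z (n + m) (sum_rel n P Q) (append_fun n \<epsilon> \<delta>)"
  let ?l = "\<lambda>h. restrict h {1..n} :: nat \<Rightarrow> spos"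
  let ?r = "\<lambda>h. restrict (\<lambda>i. h (n + i)) {1..m} :: nat \<Rightarrow> spos"
  let ?join = "\<lambda>f g. restrict (append_fun n f g) {1..n + m} :: nat \<Rightarrow> spos"
  \<comment> \<open>The inverse of gluing; the splitting of \<open>e\<close> is recovered from the
    weights of the two blocks.\<close>
  let ?split = "\<lambda>h. ((weight_exponent n \<epsilon> (?l h), weight_exponent m \<delta> (?r h)), ?l h, ?r h)"
  have l: "?l (?join f g) = f" if "f \<in> extensional {1..n}" for f g
    using that by (intro extensionalityI[where A = "{1..n}"]) (auto simp: append_fun_def)
  have r: "?r (?join f g) = g" if "g \<in> extensional {1..m}" for f g
    using that by (intro extensionalityI[where A = "{1..m}"]) (auto simp: append_fun_def)
  have join: "?join (?l h) (?r h) = h" if "h \<in> extensional {1..n + m}" for h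
    using that by (intro extensionalityI[where A = "{1..n + m}"]) (auto simp: append_fun_def)
  have wt: "weight_exponent (n + m) (append_fun n \<epsilon> \<delta>) h
      = weight_exponent n \<epsilon> (?l h) + weight_exponent m \<delta> (?r h)" for h
    unfolding weight_exponent_append
    by (intro arg_cong2[where f = "(+)"] weight_exponent_cong) auto
  have ext: "f \<in> enriched_partitions Z k S \<Longrightarrow> f \<in> extensional {1..k}" for f k S
    by (simp add: enriched_partitions_def PiE_def)
  have mem: "h \<in> ?C e \<longleftrightarrow> (\<exists>a b. a + b = e \<and> ?l h \<in> ?A a \<and> ?r h \<in> ?B b)"
    if "h \<in> extensional {1..n + m}" for h
    using enriched_partitions_sum_rel[OF P Q that, of Z]
    by (auto simp: partitions_of_weight_def wt)
  have "coeff (gen_fun Z n P \<epsilon> * gen_fun Z m Q \<delta> :: (pos, 'k) mpowser) e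
      = (\<Sum>x\<in>splits e. \<Sum>y\<in>?A (fst x) \<times> ?B (snd x). 1)"
    by (simp add: times_mpowser.rep_eq coeff_gen_fun sum_product sum.cartesian_product
          case_prod_unfold)
  also have "\<dots> = (\<Sum>(x, y)\<in>(SIGMA x:splits e. ?A (fst x) \<times> ?B (snd x)). 1)"
    by (rule sum.Sigma) (auto simp: finite_splits finite_partitions_of_weight)
  also have "\<dots> = (\<Sum>h\<in>?C e. 1)"
  proof (rule sum.reindex_bij_witness
[where j = "\<lambda>(x, f, g). ?join f g" and i = ?split])
    fix h assume h: "h \<in> ?C e"
    then have "h \<in> extensional {1..n + m}"
      using ext by (auto simp: partitions_of_weight_def)
    with h mem[of h] join[of h]
    show "(case ?split h of (x, f, g) \<Rightarrow> ?join f g) = h"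
      and "?split h \<in> (SIGMA x:splits e. ?A (fst x) \<times> ?B (snd x))"
      by (auto simp: splits_def partitions_of_weight_def)
  next
    fix p assume "p \<in> (SIGMA x:splits e. ?A (fst x) \<times> ?B (snd x))"
    then obtain a b f g where p: "p = ((a, b), f, g)" "a + b = e" "f \<in> ?A a" "g \<in> ?B b"
      by (auto simp: splits_def)
    then have lr: "?l (?join f g) = f" "?r (?join f g) = g"
      using ext by (auto simp only: partitions_of_weight_def l r)
    define h where "h = ?join f g"
    have "h \<in> ?C e"
      using mem[of h] p lr unfolding h_def[symmetric] by (auto simp: h_def)
    then show "(case p of (x, f, g) \<Rightarrow> ?join f g) \<in> ?C e"
      by (simp add: p h_def)
    show "?split (case p of (x, f, g) \<Rightarrow> ?join f g) = p"
      using p lr by (simp add: partitions_of_weight_def)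
  qed auto
  finally show "coeff (gen_fun Z n P \<epsilon> * gen_fun Z m Q \<delta> :: (pos, 'k) mpowser) e
      = coeff (gen_fun Z (n + m) (sum_rel n P Q) (append_fun n \<epsilon> \<delta>)) e"
    by (simp add: coeff_gen_fun)
qed

section \<open>Decomposition into linear extensions\<close>

text \<open>Ties are broken by label, upwards at positive values and downwards at negative ones:
  exactly the equalities that enriched partitions tolerate.\<close>

definition induced_order :: "nat \<Rightarrow> (nat \<Rightarrow> spos) \<Rightarrow> nat rel" where
  "induced_order n h = {(i, j). i \<in> {1..n} \<and> j \<in> {1..n} \<and>
     (h i < h j \<or> h i = h j \<and> (if h i \<in> range Plus then i < j else j < i))}"

text \<open>Irreflexivity gives \<open>i \<noteq> j\<close> on \<open>P\<close>, so exactly one of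
  the two clauses is active, and it agrees with the tie rule of the induced order.\<close>

lemma enriched_partitions_iff_induced_order:
  assumes "P \<subseteq> {1..n} \<times> {1..n}" and "irrefl P"
  shows "h \<in> enriched_partitions Z n P \<longleftrightarrow> h \<in> {1..n} \<rightarrow>\<^sub>E Z \<and> P \<subseteq> induced_order n h"
proof -
  \<comment> \<open>Every value has exactly one sign, so the \<open>else\<close> branch of
    \<open>induced_order\<close> is the case of negative values.\<close>
  have *: "h i \<in> range Minus \<longleftrightarrow> h i \<notin> range Plus" for i
    by (cases "h i") auto
  have ok: "((i < j \<longrightarrow> h i < h j \<or> (h i = h j \<and> h i \<in> range Plus)) \<and>
         (i > j \<longrightarrow> h i < h j \<or> (h i = h j \<and> h i \<in> range Minus)))
      \<longleftrightarrow> (i, j) \<in> induced_order n h" if "(i, j) \<in> P" for i j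
  proof -
    have "i \<noteq> j" using that assms(2) by (auto simp: irrefl_def)
    moreover have "i \<in> {1..n}" "j \<in> {1..n}" using that assms(1) by auto
    ultimately show ?thesis unfolding induced_order_def * by auto
  qed
  have "(\<forall>(i, j)\<in>P. (i < j \<longrightarrow> h i < h j \<or> (h i = h j \<and> h i \<in> range Plus)) \<and>
         (i > j \<longrightarrow> h i < h j \<or> (h i = h j \<and> h i \<in> range Minus))) \<longleftrightarrow> (\<forall>(i, j)\<in>P. (i, j) \<in> induced_order n h)"
    by (rule ball_cong[OF refl]) (simp only: split_paired_all prod.case ok)
  also have "\<dots> \<longleftrightarrow> P \<subseteq> induced_order n h"
    by auto
  finally show ?thesis unfolding enriched_partitions_def by simp
qed

text \<open>Distinct values are compared in \<open>spos\<close>; labels sharing a value share its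
  sign, so within such a class the order is the usual one or its reverse.\<close>

lemma induced_order_strict_total:
  shows "irrefl (induced_order n h)" "trans (induced_order n h)"
    "total_on {1..n} (induced_order n h)" "induced_order n h \<subseteq> {1..n} \<times> {1..n}"
  unfolding induced_order_def irrefl_def trans_def total_on_def
  by (auto simp: image_iff split: if_splits) metis

section \<open>Strict total orders on \<open>{1..n}\<close> and permutations\<close>

lemma strict_total_subset_eq:
  assumes "irrefl S" "trans S" "S \<subseteq> A \<times> A" "total_on A R" "R \<subseteq> S"
  shows "R = S"
proof
  show "S \<subseteq> R"
  proof
    fix p assume "p \<in> S"
    then obtain x y where p: "p = (x, y)" "(x, y) \<in> S" by (cases p) auto
    then have "x \<noteq> y" "(y, x) \<notin> S" using assms(1,2) by (auto simp: irrefl_def dest: transD)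
    \<comment> \<open>If \<open>(x, y)\<close> were missing from \<open>R\<close>, totality would
      put \<open>(y, x)\<close> into \<open>R\<close> and hence into \<open>S\<close>.\<close>
    with p assms(3-5) show "p \<in> R" by (auto simp: total_on_def)
  qed
qed fact

text \<open>\<open>inv \<tau> x\<close> is the position of the letter \<open>x\<close> in the word
  of \<open>\<tau>\<close>, and the order compares positions.\<close>

lemma perm_order_iff:
  assumes "\<tau> permutes {1..n}"
  shows "(x, y) \<in> perm_order n \<tau> \<longleftrightarrow> x \<in> {1..n} \<and> y \<in> {1..n} \<and> inv \<tau> x < inv \<tau> y"
proof
  assume "(x, y) \<in> perm_order n \<tau>"
  then obtain i j where "x = \<tau> i" "y = \<tau> j" "i \<in> {1..n}" "j \<in> {1..n}" "i < j"
    by (auto simp: perm_order_def)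
  then show "x \<in> {1..n} \<and> y \<in> {1..n} \<and> inv \<tau> x < inv \<tau> y"
    using permutes_in_image[OF assms] permutes_inverses[OF assms] by simp
next
  assume *: "x \<in> {1..n} \<and> y \<in> {1..n} \<and> inv \<tau> x < inv \<tau> y"
  moreover have "x = \<tau> (inv \<tau> x)" "y = \<tau> (inv \<tau> y)"
    using permutes_inverses[OF assms] by simp_all
  moreover have "inv \<tau> x \<in> {1..n}" "inv \<tau> y \<in> {1..n}"
    using * permutes_in_image[OF permutes_inv[OF assms]] by blast+
  ultimately show "(x, y) \<in> perm_order n \<tau>"
    unfolding perm_order_def by blast
qed

text \<open>The inverse of \<open>\<tau>\<close> sends an element to its rank.\<close>

lemma strict_total_order_eq_perm_order:
  assumes irr: "irrefl S" and tr: "trans S" and S: "S \<subseteq> {1..n} \<times> {1..n}"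
    and tot: "total_on {1..n} S"
  obtains \<tau> where "\<tau> permutes {1..n}" "perm_order n \<tau> = S"
proof -
  define below where "below x = {z. (z, x) \<in> S}" for x
  \<comment> \<open>\<open>Suc\<close> makes ranks start at 1; outside the interval
    \<open>permutes\<close> forces the identity.\<close>
  define \<rho> where "\<rho> x = (if x \<in> {1..n} then Suc (card (below x)) else x)" for x
  have fin: "finite (below x)" for x
    by (rule finite_subset[of _ "{1..n}"]) (use S in \<open>auto simp: below_def\<close>)
  have mono: "\<rho> x < \<rho> y" if "(x, y) \<in> S" for x y
  proof -
    have "below x \<subset> below y"
      using that tr irr by (auto simp: below_def irrefl_def dest: transD)
    then have "card (below x) < card (below y)" using fin psubset_card_mono by blast
    then show ?thesis using that S by (auto simp: \<rho>_def)
  qed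
  have "\<rho> x \<in> {1..n}" if "x \<in> {1..n}" for x
  proof -
    have "below x \<subset> {1..n}"
      using that S irr by (auto simp: below_def irrefl_def)
    then have "card (below x) < card {1..n}" by (intro psubset_card_mono) auto
    then show ?thesis using that by (simp add: \<rho>_def)
  qed
  then have "\<rho> ` {1..n} \<subseteq> {1..n}" by blast
  moreover have inj: "inj_on \<rho> {1..n}"
  proof (rule inj_onI, rule ccontr)
    fix x y assume "x \<in> {1..n}" "y \<in> {1..n}" "\<rho> x = \<rho> y" "x \<noteq> y"
    then have "(x, y) \<in> S \<or> (y, x) \<in> S" using tot by (simp add: total_on_def)
    with mono[of x y] mono[of y x] \<open>\<rho> x = \<rho> y\<close> show False by auto
  qed
  ultimately have "bij_betw \<rho> {1..n} {1..n}"
    by (simp add: bij_betw_def endo_inj_surj)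
  then have \<rho>: "\<rho> permutes {1..n}"
    by (rule bij_imp_permutes) (auto simp: \<rho>_def)
  have \<tau>: "inv \<rho> permutes {1..n}" by (rule permutes_inv[OF \<rho>])
  have inv: "inv (inv \<rho>) = \<rho>" by (rule inv_inv_eq[OF permutes_bij[OF \<rho>]])
  \<comment> \<open>One inclusion suffices, since a total order cannot be properly contained in a
    strict order on the same set.\<close>
  have "S \<subseteq> perm_order n (inv \<rho>)"
    using mono S by (auto simp: perm_order_iff[OF \<tau>] inv)
  moreover have "labelled_poset n (perm_order n (inv \<rho>))"
    by (rule labelled_poset_perm_order[OF \<tau>])
  ultimately have "S = perm_order n (inv \<rho>)"
    using tot by (intro strict_total_subset_eq) (auto simp: labelled_poset_def)
  with \<tau> that show ?thesis by blast
qed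

section \<open>Sorted words and one-line notation\<close>

lemma sorted_wrt_unique:
  assumes "sorted_wrt R xs" "sorted_wrt R ys" "set xs = set ys" "distinct xs" "distinct ys" "asymp R"
  shows "xs = ys"
  using assms
proof (induction xs arbitrary: ys)
  case (Cons x xs)
  then obtain y ys' where ys: "ys = y # ys'" by (cases ys) auto
  have "x = y"
  proof (rule ccontr)
    assume "x \<noteq> y"
    \<comment> \<open>Different heads would each occur in the tail of the other list, so each would
      precede the other.\<close>
    then have "y \<in> set xs" "x \<in> set ys'"
      using Cons.prems(3) unfolding ys by auto
    then have "R x y" "R y x"
      using Cons.prems(1,2) unfolding ys by auto
    with \<open>asymp R\<close> show False by (blast dest: asympD)
  qed
  then have "set xs = set ys'"
    using Cons.prems unfolding ys by (auto simp: insert_eq_iff)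
  with Cons \<open>x = y\<close> show ?case unfolding ys by auto
qed simp

lemma length_one_line: "length (one_line n \<tau>) = n"
  by (simp add: one_line_def)

lemma set_one_line: "\<tau> permutes {1..n} \<Longrightarrow> set (one_line n \<tau>) = {1..n}"
  by (simp add: one_line_def atLeastLessThanSuc_atLeastAtMost permutes_image del: upt_Suc)

lemma distinct_one_line: "\<tau> permutes {1..n} \<Longrightarrow> distinct (one_line n \<tau>)"
  by (simp add: one_line_def distinct_map permutes_inj_on)

text \<open>Translates inclusions between orders into sortedness of words: the pairs of
  \<open>perm_order n \<tau>\<close> are the pairs of letters in order of occurrence.\<close>

lemma sorted_wrt_one_line_iff:
  "sorted_wrt R (one_line n \<tau>) \<longleftrightarrow> (\<forall>(x, y)\<in>perm_order n \<tau>. R x y)"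
proof -
  have "sorted_wrt (\<lambda>i j. R (\<tau> i) (\<tau> j)) [1..<n + 1] \<longleftrightarrow>
      (\<forall>i\<in>{1..n}. \<forall>j\<in>{1..n}. i < j \<longrightarrow> R (\<tau> i) (\<tau> j))" (is "?L \<longleftrightarrow> ?R")
  proof
    assume L: ?L
    show ?R
    proof (intro ballI impI)
      fix i j assume "i \<in> {1..n}" "j \<in> {1..n}" "i < j"
      \<comment> \<open>List positions count from 0, so \<open>i\<close> sits at position
        \<open>i - 1\<close> of \<open>[1..<n + 1]\<close>.\<close>
      then show "R (\<tau> i) (\<tau> j)"
        using sorted_wrt_nth_less[OF L, of "i - 1" "j - 1"] by (auto simp del: upt_Suc)
    qed
  next
    assume ?R
    then show ?L
      by (intro sorted_wrt_mono_rel[OF _ sorted_wrt_upt]) auto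
  qed
  then show ?thesis
    unfolding one_line_def sorted_wrt_map perm_order_def by blast
qed

text \<open>The order determines the word as the unique sorted arrangement of \<open>{1..n}\<close>;
  outside this interval both permutations are the identity.\<close>

lemma perm_order_inj:
  assumes \<tau>: "\<tau> permutes {1..n}" and \<tau>': "\<tau>' permutes {1..n}"
    and eq: "perm_order n \<tau> = perm_order n \<tau>'"
  shows "\<tau> = \<tau>'"
proof
  fix i
  have "one_line n \<tau> = one_line n \<tau>'"
    by (rule sorted_wrt_unique[of "\<lambda>x y. (x, y) \<in> perm_order n \<tau>"])
       (auto simp: eq[symmetric] sorted_wrt_one_line_iff set_one_line[OF \<tau>] set_one_line[OF \<tau>']
          perm_order_iff[OF \<tau>] distinct_one_line[OF \<tau>] distinct_one_line[OF \<tau>'] intro!: asympI)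
  then have "\<tau> i = \<tau>' i" if "i \<in> {1..n}"
    using that by (auto simp: one_line_def simp del: upt_Suc)
  then show "\<tau> i = \<tau>' i"
    using permutes_not_in[OF \<tau>] permutes_not_in[OF \<tau>'] by metis
qed

text \<open>A linear extension is encoded by the permutation that lists the labels in increasing
  order; by the preceding results this loses and repeats nothing.\<close>

definition linear_extensions :: "nat \<Rightarrow> nat rel \<Rightarrow> (nat \<Rightarrow> nat) set" where
  "linear_extensions n P = {\<tau>. \<tau> permutes {1..n} \<and> P \<subseteq> perm_order n \<tau>}"

text \<open>Since \<open>perm_order n \<tau>\<close> is total, its inclusion in the induced order is
  an equality.\<close>

lemma enriched_partitions_perm_order_iff:
  assumes "\<tau> permutes {1..n}"
  shows "h \<in> enriched_partitions Z n (perm_order n \<tau>) \<longleftrightarrow>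
    h \<in> {1..n} \<rightarrow>\<^sub>E Z \<and> perm_order n \<tau> = induced_order n h"
proof -
  have "labelled_poset n (perm_order n \<tau>)" and "total_on {1..n} (perm_order n \<tau>)"
    using labelled_poset_perm_order[OF assms] by blast+
  then show ?thesis
    using strict_total_subset_eq[OF induced_order_strict_total(1,2,4)]
    by (subst enriched_partitions_iff_induced_order) (auto simp: labelled_poset_def)
qed

text \<open>Each \<open>h\<close> belongs to exactly one permutation, the one whose order
  \<open>h\<close> induces. At a fixed weight this is a finite disjoint union, so the coefficients
  add up.\<close>

lemma gen_fun_eq_sum_linear_extensions:
  assumes "P \<subseteq> {1..n} \<times> {1..n}" and "irrefl P"
  shows "gen_fun Z n P \<epsilon> = (\<Sum>\<tau>\<in>linear_extensions n P.
    gen_fun Z n (perm_order n \<tau>) \<epsilon> :: (pos, 'k::{comm_ring, comm_monoid_mult}) mpowser)"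
proof (rule mpowser_eqI)
  fix e
  let ?A = "\<lambda>\<tau>. partitions_of_weight Z n (perm_order n \<tau>) \<epsilon> e"
  have "partitions_of_weight Z n P \<epsilon> e = (\<Union>\<tau>\<in>linear_extensions n P. ?A \<tau>)"
  proof (intro equalityI subsetI)
    fix h assume h: "h \<in> partitions_of_weight Z n P \<epsilon> e"
    \<comment> \<open>This \<open>\<tau>\<close> extends \<open>P\<close> because \<open>h\<close>
      is an enriched \<open>P\<close>-partition.\<close>
    obtain \<tau> where "\<tau> permutes {1..n}" "perm_order n \<tau> = induced_order n h"
      using strict_total_order_eq_perm_order induced_order_strict_total by metis
    with h show "h \<in> (\<Union>\<tau>\<in>linear_extensions n P. ?A \<tau>)"
      using enriched_partitions_iff_induced_order[OF assms, of h Z]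
      by (auto simp: partitions_of_weight_def linear_extensions_def
            enriched_partitions_perm_order_iff)
  next
    fix h assume "h \<in> (\<Union>\<tau>\<in>linear_extensions n P. ?A \<tau>)"
    then show "h \<in> partitions_of_weight Z n P \<epsilon> e"
      using enriched_partitions_iff_induced_order[OF assms, of h Z]
      by (auto simp: partitions_of_weight_def linear_extensions_def
            enriched_partitions_perm_order_iff)
  qed
  moreover have "finite (linear_extensions n P)"
    by (rule finite_subset[OF _ finite_permutations[of "{1..n}"]])
       (auto simp: linear_extensions_def)
  \<comment> \<open>A common member would make both permutation orders equal to its induced
    order.\<close>
  moreover have "?A \<tau> \<inter> ?A \<tau>' = {}"
    if "\<tau> \<in> linear_extensions n P" "\<tau>' \<in> linear_extensions n P" "\<tau> \<noteq> \<tau>'" for \<tau> \<tau>'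
    using that perm_order_inj[of \<tau> n \<tau>']
    by (auto simp: partitions_of_weight_def linear_extensions_def
          enriched_partitions_perm_order_iff)
  ultimately show "coeff (gen_fun Z n P \<epsilon> :: (pos, 'k) mpowser) e
      = coeff (\<Sum>\<tau>\<in>linear_extensions n P. gen_fun Z n (perm_order n \<tau>) \<epsilon>) e"
    by (simp add: coeff_gen_fun coeff_sum sum.UNION_disjoint finite_partitions_of_weight)
qed

section \<open>Shuffles as linear extensions\<close>

text \<open>The alphabets of the two words are disjoint, so a shuffle returns each word when
  filtered by its alphabet. Both words then inherit sortedness from the word of
  \<open>\<tau>\<close>; conversely, uniqueness of sorted words identifies the filtered
  words.\<close>

lemma one_line_in_shuffles_iff:
  assumes \<pi>: "\<pi> permutes {1..n}" and \<sigma>: "\<sigma> permutes {1..m}" and \<tau>: "\<tau> permutes {1..n + m}"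
  shows "one_line (n + m) \<tau> \<in> shuffles (one_line n \<pi>) (map (\<lambda>s. n + s) (one_line m \<sigma>)) \<longleftrightarrow>
    sum_rel n (perm_order n \<pi>) (perm_order m \<sigma>) \<subseteq> perm_order (n + m) \<tau>"
proof -
  let ?t = "one_line (n + m) \<tau>"
  let ?xs = "one_line n \<pi>" and ?ys = "map (\<lambda>s. n + s) (one_line m \<sigma>)"
  let ?R = "\<lambda>x y. (x, y) \<in> perm_order (n + m) \<tau>"
  have asym: "asymp ?R"
    by (rule asympI) (auto simp: perm_order_iff[OF \<tau>])
  have t: "sorted_wrt ?R ?t" by (auto simp: sorted_wrt_one_line_iff)
  have sets: "set ?t = {1..n + m}" "set ?xs = {1..n}" "set ?ys = (+) n ` {1..m}"
    using set_one_line[OF \<tau>] set_one_line[OF \<pi>] set_one_line[OF \<sigma>] by simp_all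
  have dist: "distinct ?t" "distinct ?xs" "distinct ?ys"
    using distinct_one_line[OF \<tau>] distinct_one_line[OF \<pi>] distinct_one_line[OF \<sigma>]
    by (simp_all add: distinct_map)
  have disj: "set ?xs \<inter> set ?ys = {}" unfolding sets by auto
  have rest: "set (filter (\<lambda>x. x \<notin> set ?xs) ?t) = set ?ys"
    unfolding set_filter sets by (auto simp: image_iff)
  have first: "set (filter (\<lambda>x. x \<in> set ?xs) ?t) = set ?xs"
    unfolding set_filter sets by auto
  have srt: "sum_rel n (perm_order n \<pi>) (perm_order m \<sigma>) \<subseteq> perm_order (n + m) \<tau> \<longleftrightarrow>
      sorted_wrt ?R ?xs \<and> sorted_wrt ?R ?ys"
    by (auto simp: sum_rel_def sorted_wrt_map sorted_wrt_one_line_iff)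
  show ?thesis unfolding srt
  proof
    assume "?t \<in> shuffles ?xs ?ys"
    then have "filter (\<lambda>x. x \<in> set ?xs) ?t = ?xs" "filter (\<lambda>x. x \<notin> set ?xs) ?t = ?ys"
      using filter_shuffles_disjoint1[OF disj] by blast+
    then show "sorted_wrt ?R ?xs \<and> sorted_wrt ?R ?ys"
      using t by (metis sorted_wrt_filter)
  next
    assume *: "sorted_wrt ?R ?xs \<and> sorted_wrt ?R ?ys"
    have "filter (\<lambda>x. x \<in> set ?xs) ?t = ?xs"
      by (rule sorted_wrt_unique[of ?R]) (use * t dist first asym sorted_wrt_filter in auto)
    moreover have "filter (\<lambda>x. x \<notin> set ?xs) ?t = ?ys"
      by (rule sorted_wrt_unique[of ?R]) (use * t dist rest asym sorted_wrt_filter in auto)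
    \<comment> \<open>Any list is a shuffle of the sublists satisfying and violating a
      predicate.\<close>
    ultimately show "?t \<in> shuffles ?xs ?ys"
      using partition_in_shuffles[of ?t "\<lambda>x. x \<in> set ?xs"] by simp
  qed
qed

text \<open>Each entry of \<open>\<gamma>\<close> is the weight \<open>w\<close> of the letter of
  \<open>\<tau>\<close> at that position, so \<open>\<tau>\<close> determines
  \<open>\<gamma>\<close> and only the shuffle condition remains.\<close>

lemma coshuffle_eq_image:
  assumes \<pi>: "\<pi> permutes {1..length \<alpha>}" and \<sigma>: "\<sigma> permutes {1..length \<beta>}"
  defines "n \<equiv> length \<alpha>" and "m \<equiv> length \<beta>"
  defines "w \<equiv> append_fun n (perm_weight \<pi> \<alpha>) (perm_weight \<sigma> \<beta>)"
  shows "coshuffle \<pi> \<alpha> \<sigma> \<beta> = (\<lambda>\<tau>. (\<tau>, map w (one_line (n + m) \<tau>))) `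
    linear_extensions (n + m) (sum_rel n (perm_order n \<pi>) (perm_order m \<sigma>))"
proof -
  have entries: "length \<gamma> = n + m \<and> (\<forall>k\<in>{1..n + m}.
           (\<forall>i\<in>{1..n}. \<tau> k = \<pi> i \<longrightarrow> \<gamma> ! (k - 1) = \<alpha> ! (i - 1)) \<and>
           (\<forall>j\<in>{1..m}. \<tau> k = n + \<sigma> j \<longrightarrow> \<gamma> ! (k - 1) = \<beta> ! (j - 1)))
    \<longleftrightarrow> \<gamma> = map w (one_line (n + m) \<tau>)" (is "?len \<and> (\<forall>k\<in>_. ?E k) \<longleftrightarrow> _")
    if \<tau>: "\<tau> permutes {1..n + m}" for \<tau> \<gamma>
  proof -
    have "?E k \<longleftrightarrow> \<gamma> ! (k - 1) = w (\<tau> k)" if k: "k \<in> {1..n + m}" for k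
    proof -
      have \<tau>k: "\<tau> k \<in> {1..n + m}" using permutes_in_image[OF \<tau>] k by blast
      have in\<pi>: "\<pi> i \<in> {1..n} \<longleftrightarrow> i \<in> {1..n}" for i
        using permutes_in_image[OF \<pi>] by (simp add: n_def)
      have in\<sigma>: "\<sigma> i \<in> {1..m} \<longleftrightarrow> i \<in> {1..m}" for i
        using permutes_in_image[OF \<sigma>] by (simp add: m_def)
      have w\<pi>: "w (\<pi> i) = \<alpha> ! (i - 1)" if "i \<in> {1..n}" for i
        using in\<pi>[of i] that perm_weight_apply[OF \<pi>] by (simp add: w_def append_fun_def)
      have w\<sigma>: "w (n + \<sigma> i) = \<beta> ! (i - 1)" if "i \<in> {1..m}" for i
        using in\<sigma>[of i] that perm_weight_apply[OF \<sigma>] by (simp add: w_def append_fun_def)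
      \<comment> \<open>The two words together contain every label, so some clause of
        \<open>?E k\<close> fixes the entry.\<close>
      consider i where "i \<in> {1..n}" "\<tau> k = \<pi> i" | j where "j \<in> {1..m}" "\<tau> k = n + \<sigma> j"
      proof (cases "\<tau> k \<le> n")
        case True
        then have "\<tau> k \<in> \<pi> ` {1..n}"
          using \<tau>k permutes_image[OF \<pi>] by (simp add: n_def)
        then show ?thesis using that(1) by blast
      next
        case False
        then have "\<tau> k - n \<in> \<sigma> ` {1..m}"
          using \<tau>k permutes_image[OF \<sigma>] by (auto simp: m_def)
        then obtain j where "j \<in> {1..m}" "\<tau> k - n = \<sigma> j" by blast
        with False show ?thesis using that(2)[of j] by simp
      qed
      then show ?thesis
        using w\<pi> w\<sigma> by cases metis+
    qed
    \<comment> \<open>Writing the interval as an image under \<open>Suc\<close> matches positions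
      \<open>k\<close> counted from 1 with list indices \<open>k - 1\<close>.\<close>
    then have "(\<forall>k\<in>{1..n + m}. ?E k) \<longleftrightarrow> (\<forall>k\<in>Suc ` {..<n + m}. \<gamma> ! (k - 1) = w (\<tau> k))"
      unfolding image_Suc_lessThan by (intro ball_cong) auto
    then show ?thesis
      by (auto simp: list_eq_iff_nth_eq one_line_def simp del: upt_Suc)
  qed
  have "(\<tau>, \<gamma>) \<in> coshuffle \<pi> \<alpha> \<sigma> \<beta> \<longleftrightarrow>
      \<tau> \<in> linear_extensions (n + m) (sum_rel n (perm_order n \<pi>) (perm_order m \<sigma>)) \<and>
      \<gamma> = map w (one_line (n + m) \<tau>)" for \<tau> \<gamma>
    using one_line_in_shuffles_iff[OF \<pi> \<sigma>, folded n_def m_def] entries[of \<tau> \<gamma>]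
    unfolding coshuffle_def Let_def n_def[symmetric] m_def[symmetric] linear_extensions_def
      mem_Collect_eq prod.case
    by blast
  then show ?thesis by auto
qed

section \<open>Product formula for universal quasisymmetric functions\<close>

theorem theorem3:
  fixes Z :: "spos set"
    and n m :: nat
    and \<pi> \<sigma> :: "nat \<Rightarrow> nat"
    and \<alpha> \<beta> :: "pos list"
  assumes "\<pi> permutes {1..n}" and "\<sigma> permutes {1..m}"
    and "length \<alpha> = n" and "length \<beta> = m"
  shows "(univ_qsym Z \<pi> \<alpha> :: (pos, 'k::{comm_ring, comm_monoid_mult}) mpowser) * univ_qsym Z \<sigma> \<beta>
       = (\<Sum>(\<tau>, \<gamma>)\<in>coshuffle \<pi> \<alpha> \<sigma> \<beta>. univ_qsym Z \<tau> \<gamma>)"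
proof -
  let ?P = "perm_order n \<pi>" and ?Q = "perm_order m \<sigma>"
  let ?R = "sum_rel n ?P ?Q"
  let ?w = "append_fun n (perm_weight \<pi> \<alpha>) (perm_weight \<sigma> \<beta>)"
  have P: "?P \<subseteq> {1..n} \<times> {1..n}" "irrefl ?P" and Q: "?Q \<subseteq> {1..m} \<times> {1..m}" "irrefl ?Q"
    using labelled_poset_perm_order(1)[OF assms(1)] labelled_poset_perm_order(1)[OF assms(2)]
    by (auto simp: labelled_poset_def)
  have R: "?R \<subseteq> {1..n + m} \<times> {1..n + m}" "irrefl ?R"
    using P Q by (fastforce simp: sum_rel_def irrefl_def)+
  \<comment> \<open>Reading \<open>?w\<close> along the word of \<open>\<tau>\<close> and pulling
    the list back through \<open>inv \<tau>\<close> returns \<open>?w\<close> on the labels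
    \<open>{1..n + m}\<close>, which are all that the generating function sees.\<close>
  have qsym: "gen_fun Z (n + m) (perm_order (n + m) \<tau>) ?w
      = (univ_qsym Z \<tau> (map ?w (one_line (n + m) \<tau>)) :: (pos, 'k) mpowser)"
    if \<tau>: "\<tau> permutes {1..n + m}" for \<tau>
  proof -
    have "perm_weight \<tau> (map ?w (one_line (n + m) \<tau>)) i = ?w i" if "i \<in> {1..n + m}" for i
    proof -
      have "inv \<tau> i \<in> {1..n + m}"
        using permutes_in_image[OF permutes_inv[OF \<tau>]] that by blast
      then show ?thesis
        using permutes_inverses(1)[OF \<tau>, of i]
        by (auto simp: perm_weight_def one_line_def simp del: upt_Suc)
    qed
    then show ?thesis
      by (auto simp: univ_qsym_def length_one_line intro: gen_fun_cong)
  qed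
  have "(univ_qsym Z \<pi> \<alpha> :: (pos, 'k) mpowser) * univ_qsym Z \<sigma> \<beta> = gen_fun Z (n + m) ?R ?w"
    unfolding univ_qsym_def assms(3,4) by (rule gen_fun_mult[OF P(1) Q(1)])
  also have "\<dots> = (\<Sum>\<tau>\<in>linear_extensions (n + m) ?R. gen_fun Z (n + m) (perm_order (n + m) \<tau>) ?w)"
    by (rule gen_fun_eq_sum_linear_extensions[OF R])
  also have "\<dots> = (\<Sum>\<tau>\<in>linear_extensions (n + m) ?R.
      univ_qsym Z \<tau> (map ?w (one_line (n + m) \<tau>)))"
    by (rule sum.cong) (auto simp: linear_extensions_def qsym)
  also have "\<dots> = (\<Sum>(\<tau>, \<gamma>)\<in>coshuffle \<pi> \<alpha> \<sigma> \<beta>. univ_qsym Z \<tau> \<gamma>)"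
    \<comment> \<open>The map onto the coshuffle keeps \<open>\<tau>\<close> as first component, so
      it is injective and the sum can be reindexed.\<close>
    using coshuffle_eq_image[of \<pi> \<alpha> \<sigma> \<beta>] assms by (simp add: sum.reindex inj_on_def)
  finally show ?thesis .
qed

end
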